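(* Let $p,q>1$ satisfy $\frac1p+\frac1q\ge1$. Let $f\in\mathcal E^p$ and $g\in\mathcal E^q$. Suppose, in addition, that there exist $r,s\ge1$ such that $f$ has finite $r$-variation, $g$ has finite $s$-variation, and $$\frac1r+\frac1s>1.$$ Then the classical Young integrals $\int_0^t f\,d^Yg$ and $\int_0^t g\,d^Yf$ exist, and $$I_{f,g}(t)=\int_0^t f\,d^Yg,\qquad I_{g,f}(t)=\int_0^t g\,d^Yf,\qquad t\in[0,1],$$ where $I_{f,g}$, $I_{g,f}$ are the Faber--Schauder integrals.
   Context: $C([0,1])$ denotes the real-valued continuous functions on $[0,1]$, $\|\cdot\|_\infty$ the uniform norm. A function $f\in C([0,1])$ has finite $r$-variation ($r\ge1$) if $\sup\sum_{i=1}^N|f(t_i)-f(t_{i-1})|^r<\infty$, the supremum being over all partitions $0=t_0<\dots<t_N=1$ of $[0,1]$. $\int_0^t f\,d^Yg$ denotes the classical Young integral, i.e. the limit of Riemann--Stieltjes sums $\sum_i f(\xi_i)(g(s_{i+1})-g(s_i))$, $\xi_i\in[s_i,s_{i+1}]$, over partitions of $[0,t]$ with mesh tending to zero. $\mathbb N_0=\{0,1,2,\dots\}$, $\mathbb N_{-1}=\{-1,0,1,\dots\}$. For $n\in\mathbb N_0$: $t_{n,k}=k2^{-n}$ for $0\le k\le 2^n$, $\mathbb T_n=\{t_{n,k}:0\le k\le 2^n\}$, $\mathbb T=\bigcup_{n\ge0}\mathbb T_n$, $I_n=\{0,\dots,2^n-1\}$; for $t\in\mathbb T$, $\ell(t)=\min\{m\ge0:t\in\mathbb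 T_m\}$. Dyadic left sums: for $f,g\in C([0,1])$, $t\in\mathbb T$, $n\ge\ell(t)$, $$S_n^L(t;f,g)=\sum_{k=0}^{2^nt-1}f(t_{n,k})\big(g(t_{n,k+1})-g(t_{n,k})\big)$$ (empty sum $=0$). The dyadic integral over $[0,t]$ exists if $(S_n^L(t;f,g))_{n\ge\ell(t)}$ converges, and its limit is denoted $I^{\mathbb T}_{f,g}(t)$. Faber--Schauder integral: if $I^{\mathbb T}_{f,g}(t)$ exists for every $t\in\mathbb T$ and the map $I^{\mathbb T}_{f,g}:\mathbb T\to\mathbb R$ admits a (necessarily unique) continuous extension to $[0,1]$, this extension is denoted $I_{f,g}:[0,1]\to\mathbb R$ and one says that the Faber--Schauder integral $I_{f,g}$ exists on $[0,1]$. (Both $I_{f,g}$ and $I_{g,f}$ exist when $f\in\mathcal E^p$, $g\in\mathcal E^q$ with $\frac1p+\frac1q\ge1$.) Faber--Schauder coefficients of $f\in C([0,1])$: $\theta^f_{-1,0}=f(1)-f(0)$, and for $n\ge0$, $k\in I_n$, $\theta^f_{n,k}=2^{n/2}\big(2f(t_{n+1,2k+1})-f(t_{n,k})-f(t_{n,k+1})\big)$. Level energies ($p>1$): $\zeta_f^{(p)}(-1)=2^{1-\frac1p}|\theta^f_{-1,0}|$ and $\zeta_f^{(p)}(n)=\big(2^{-np/2}\sum_{k\in I_n}|\theta^f_{n,k}|^p\big)^{1/p}$ for $n\ge0$. Schauder tail sequence: $H_f(n)=\sum_{m=n}^\infty 2^{-m/2}\sup_{k\in I_m}|\theta^f_{m,k}|\in[0,\infty]$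 for $n\ge0$. Energy space ($p>1$): $\|f\|_{\mathcal E^p}=\|f\|_\infty+\|\zeta_f^{(p)}\|_{\ell^p(\mathbb N_{-1})}+\|H_f\|_{\ell^p(\mathbb N_0)}$ and $\mathcal E^p=\{f\in C([0,1]):\|f\|_{\mathcal E^p}<\infty\}$. *)

theory Defs
  imports "HOL-Analysis.Analysis"
begin

text \<open>
  An element of \<open>C([0,1])\<close> is represented by a function \<open>f :: real \<Rightarrow> real\<close> with
  \<open>continuous_on {0..1} f\<close>; its values outside \<open>[0,1]\<close> play no role.
\<close>

section \<open>Partitions, variation and the Young integral\<close>

definition is_partition :: "real \<Rightarrow> real \<Rightarrow> nat \<Rightarrow> (nat \<Rightarrow> real) \<Rightarrow> bool" where
  "is_partition a b N s \<longleftrightarrow> s 0 = a \<and> s N = b \<and> (\<forall>i<N. s i < s (Suc i))"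

definition variation :: "real \<Rightarrow> (real \<Rightarrow> real) \<Rightarrow> ennreal" where
  "variation r f = (SUP (N, s) \<in> {(N, s). is_partition 0 1 N s}.
     ennreal (\<Sum>i=1..N. \<bar>f (s i) - f (s (i - 1))\<bar> powr r))"

definition has_finite_variation :: "real \<Rightarrow> (real \<Rightarrow> real) \<Rightarrow> bool" where
  "has_finite_variation r f \<longleftrightarrow> variation r f < \<infinity>"

definition has_young_integral ::
    "(real \<Rightarrow> real) \<Rightarrow> (real \<Rightarrow> real) \<Rightarrow> real \<Rightarrow> real \<Rightarrow> real \<Rightarrow> bool" where
  "has_young_integral f g a b I \<longleftrightarrow>
     (\<forall>\<epsilon>>0. \<exists>\<delta>>0. \<forall>N s \<xi>.
        is_partition a b N s \<and> (\<forall>i<N. s (Suc i) - s i < \<delta>) \<and>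
        (\<forall>i<N. \<xi> i \<in> {s i..s (Suc i)}) \<longrightarrow>
        \<bar>(\<Sum>i<N. f (\<xi> i) * (g (s (Suc i)) - g (s i))) - I\<bar> < \<epsilon>)"

definition young_integrable :: "(real \<Rightarrow> real) \<Rightarrow> (real \<Rightarrow> real) \<Rightarrow> real \<Rightarrow> real \<Rightarrow> bool" where
  "young_integrable f g a b \<longleftrightarrow> (\<exists>I. has_young_integral f g a b I)"

definition young_integral :: "(real \<Rightarrow> real) \<Rightarrow> (real \<Rightarrow> real) \<Rightarrow> real \<Rightarrow> real \<Rightarrow> real" where
  "young_integral f g a b = (THE I. has_young_integral f g a b I)"

lemma fine_partition_exists:
  assumes "a \<le> b" "\<delta> > 0"
  shows "\<exists>N s. is_partition a b N s \<and> (\<forall>i<N. s (Suc i) - s i < \<delta>)"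
proof (cases "a = b")
  case True
  then have "is_partition a b 0 (\<lambda>_. a)" by (simp add: is_partition_def)
  then show ?thesis by blast
next
  case False
  with assms have ab: "b - a > 0" by simp
  obtain N :: nat where N: "(b - a) / \<delta> < real N" using reals_Archimedean2 by blast
  have N0: "real N > 0" using N ab \<open>\<delta> > 0\<close> by (meson divide_pos_pos less_trans)
  define s where "s i = a + real i * ((b - a) / real N)" for i
  have "(real i + 1) * h = real i * h + h" for i :: nat and h :: real by (simp add: distrib_right)
  then have step: "s (Suc i) - s i = (b - a) / real N" for i unfolding s_def of_nat_Suc by (simp only: add.commute[of 1] add_diff_cancel_left)
  have pos: "(b - a) / real N > 0" using ab N0 by simp
  have "(b - a) / real N < \<delta>" using N N0 \<open>\<delta> > 0\<close> by (simp add: field_simps)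
  moreover have "s i < s (Suc i)" for i using step[of i] pos by linarith
  moreover have "s 0 = a" by (simp add: s_def)
  moreover have "s N = b" using N0 by (simp add: s_def)
  ultimately have "is_partition a b N s \<and> (\<forall>i<N. s (Suc i) - s i < \<delta>)"
    unfolding is_partition_def step by blast
  then show ?thesis by blast
qed

lemma has_young_integral_unique:
  assumes "has_young_integral f g a b I" "has_young_integral f g a b J" "a \<le> b"
  shows "I = J"
proof (rule ccontr)
  assume "I \<noteq> J"
  then have e: "\<bar>I - J\<bar> / 2 > 0" by simp
  obtain d1 where d1: "d1 > 0" "\<forall>N s \<xi>. is_partition a b N s \<and> (\<forall>i<N. s (Suc i) - s i < d1) \<and>
        (\<forall>i<N. \<xi> i \<in> {s i..s (Suc i)}) \<longrightarrow>
        \<bar>(\<Sum>i<N. f (\<xi> i) * (g (s (Suc i)) - g (s i))) - I\<bar> < \<bar>I - J\<bar> / 2"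
    using assms(1)[unfolded has_young_integral_def, rule_format, OF e] by blast
  obtain d2 where d2: "d2 > 0" "\<forall>N s \<xi>. is_partition a b N s \<and> (\<forall>i<N. s (Suc i) - s i < d2) \<and>
        (\<forall>i<N. \<xi> i \<in> {s i..s (Suc i)}) \<longrightarrow>
        \<bar>(\<Sum>i<N. f (\<xi> i) * (g (s (Suc i)) - g (s i))) - J\<bar> < \<bar>I - J\<bar> / 2"
    using assms(2)[unfolded has_young_integral_def, rule_format, OF e] by blast
  obtain N s where P: "is_partition a b N s" "\<forall>i<N. s (Suc i) - s i < min d1 d2"
    using fine_partition_exists[of a b "min d1 d2"] assms(3) d1(1) d2(1) by auto
  have tags: "\<forall>i<N. s i \<in> {s i..s (Suc i)}" using P(1) by (auto simp: is_partition_def less_imp_le)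
  let ?S = "\<Sum>i<N. f (s i) * (g (s (Suc i)) - g (s i))"
  have "\<bar>?S - I\<bar> < \<bar>I - J\<bar> / 2" by (rule d1(2)[rule_format]) (use P tags in auto)
  moreover have "\<bar>?S - J\<bar> < \<bar>I - J\<bar> / 2" by (rule d2(2)[rule_format]) (use P tags in auto)
  moreover have "\<not> (\<bar>x - I\<bar> < \<bar>I - J\<bar> / 2 \<and> \<bar>x - J\<bar> < \<bar>I - J\<bar> / 2)" for x by argo
  ultimately show False by blast
qed

lemma young_integral_eqI:
  assumes "has_young_integral f g a b I" "a \<le> b"
  shows "young_integral f g a b = I"
  unfolding young_integral_def using assms has_young_integral_unique by blast


section \<open>Dyadic points and the Faber--Schauder integral\<close>

definition dyadic_pt :: "nat \<Rightarrow> nat \<Rightarrow> real" where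
  "dyadic_pt n k = real k / 2 ^ n"

definition dyadic_grid :: "nat \<Rightarrow> real set" where
  "dyadic_grid n = dyadic_pt n ` {0..2 ^ n}"

definition dyadics :: "real set" where
  "dyadics = (\<Union>n. dyadic_grid n)"

definition dyadic_level :: "real \<Rightarrow> nat" where
  "dyadic_level t = (LEAST m. t \<in> dyadic_grid m)"

text \<open>Only used for \<open>t \<in> dyadic_grid n\<close>, where \<open>2 ^ n * t\<close> is a natural number.\<close>

definition left_sum :: "nat \<Rightarrow> (real \<Rightarrow> real) \<Rightarrow> (real \<Rightarrow> real) \<Rightarrow> real \<Rightarrow> real" where
  "left_sum n f g t = (\<Sum>k<nat \<lfloor>2 ^ n * t\<rfloor>.
     f (dyadic_pt n k) * (g (dyadic_pt n (Suc k)) - g (dyadic_pt n k)))"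

definition dyadic_integral_exists :: "(real \<Rightarrow> real) \<Rightarrow> (real \<Rightarrow> real) \<Rightarrow> real \<Rightarrow> bool" where
  "dyadic_integral_exists f g t \<longleftrightarrow> convergent (\<lambda>n. left_sum (n + dyadic_level t) f g t)"

definition dyadic_integral :: "(real \<Rightarrow> real) \<Rightarrow> (real \<Rightarrow> real) \<Rightarrow> real \<Rightarrow> real" where
  "dyadic_integral f g t = lim (\<lambda>n. left_sum (n + dyadic_level t) f g t)"

definition is_fs_extension :: "(real \<Rightarrow> real) \<Rightarrow> (real \<Rightarrow> real) \<Rightarrow> (real \<Rightarrow> real) \<Rightarrow> bool" where
  "is_fs_extension f g F \<longleftrightarrow>
     continuous_on {0..1} F \<and> (\<forall>t\<in>dyadics. F t = dyadic_integral f g t)"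

definition fs_integral_exists :: "(real \<Rightarrow> real) \<Rightarrow> (real \<Rightarrow> real) \<Rightarrow> bool" where
  "fs_integral_exists f g \<longleftrightarrow>
     (\<forall>t\<in>dyadics. dyadic_integral_exists f g t) \<and> (\<exists>F. is_fs_extension f g F)"

text \<open>
  By density of the dyadics the chosen extension is unique on \<open>[0,1]\<close>; its values outside
  \<open>[0,1]\<close> are arbitrary.
\<close>

definition fs_integral :: "(real \<Rightarrow> real) \<Rightarrow> (real \<Rightarrow> real) \<Rightarrow> real \<Rightarrow> real" where
  "fs_integral f g = (SOME F. is_fs_extension f g F)"


section \<open>Faber--Schauder coefficients and energy spaces\<close>

text \<open>\<open>theta_init\<close> is the coefficient of index \<open>(-1,0)\<close>.\<close>

definition theta_init :: "(real \<Rightarrow> real) \<Rightarrow> real" where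
  "theta_init f = f 1 - f 0"

definition theta :: "(real \<Rightarrow> real) \<Rightarrow> nat \<Rightarrow> nat \<Rightarrow> real" where
  "theta f n k = 2 powr (real n / 2) *
     (2 * f (dyadic_pt (Suc n) (2 * k + 1)) - f (dyadic_pt n k) - f (dyadic_pt n (Suc k)))"

definition level_energy :: "real \<Rightarrow> (real \<Rightarrow> real) \<Rightarrow> int \<Rightarrow> real" where
  "level_energy p f n =
     (if n = -1 then 2 powr (1 - 1 / p) * \<bar>theta_init f\<bar>
      else (2 powr (- (real (nat n) * p / 2)) *
              (\<Sum>k<2 ^ nat n. \<bar>theta f (nat n) k\<bar> powr p)) powr (1 / p))"

text \<open>Sums in \<open>[0,\<infinity>]\<close> are sums in \<open>ennreal\<close>, where every family is summable.\<close>

definition schauder_tail :: "(real \<Rightarrow> real) \<Rightarrow> nat \<Rightarrow> ennreal" where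
  "schauder_tail f n =
     (\<Sum>\<^sub>\<infinity>m\<in>{n..}. ennreal (2 powr (- (real m / 2)) * (SUP k\<in>{..<2 ^ m}. \<bar>theta f m k\<bar>)))"

text \<open>Powers with positive exponent on \<open>[0,\<infinity>]\<close>.\<close>

definition ennpowr :: "ennreal \<Rightarrow> real \<Rightarrow> ennreal" where
  "ennpowr x a = (if x = \<infinity> then \<infinity> else ennreal (enn2real x powr a))"

definition lp_norm :: "real \<Rightarrow> 'a set \<Rightarrow> ('a \<Rightarrow> ennreal) \<Rightarrow> ennreal" where
  "lp_norm p A x = ennpowr (\<Sum>\<^sub>\<infinity>n\<in>A. ennpowr (x n) p) (1 / p)"

definition energy_norm :: "real \<Rightarrow> (real \<Rightarrow> real) \<Rightarrow> ennreal" where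
  "energy_norm p f =
     (SUP t\<in>{0..1}. ennreal \<bar>f t\<bar>)
     + lp_norm p {-1..} (\<lambda>n. ennreal (level_energy p f n))
     + lp_norm p UNIV (schauder_tail f)"

definition energy_space :: "real \<Rightarrow> (real \<Rightarrow> real) set" where
  "energy_space p = {f. continuous_on {0..1} f \<and> energy_norm p f < \<infinity>}"

end

theory Submission
  imports Defs
begin

text \<open>
  For continuous \<open>f\<close> and \<open>g\<close> of finite \<open>r\<close>- and \<open>s\<close>-variation with \<open>1/r + 1/s > 1\<close>, Young's
  theorem holds in a form that is uniform in the endpoint: the Riemann--Stieltjes sums over tagged
  partitions of \<open>[0,t]\<close> converge to the Young integral uniformly in \<open>t\<close> as the mesh tends to zero.
  The dyadic left sums are among these sums, so they converge to the Young integral at every dyadic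
  \<open>t\<close>. Uniformity makes the Young integral continuous in \<open>t\<close>, so it is the continuous extension that
  defines the Faber--Schauder integral, and density of the dyadics gives equality on \<open>[0,1]\<close>. All
  hypotheses on the variations are symmetric in \<open>f\<close> and \<open>g\<close>, so exchanging the two functions
  yields the other pair of integrals.

  Young's theorem is proved through a control. The \<open>r\<close>-variation of \<open>f\<close> over \<open>[0,t]\<close>, added to the
  \<open>s\<close>-variation of \<open>g\<close> over \<open>[0,t]\<close>, is a nondecreasing function \<open>W\<close> with
  \<open>\<bar>f y - f x\<bar>\<^sup>r \<le> W y - W x\<close> and \<open>\<bar>g y - g x\<bar>\<^sup>s \<le> W y - W x\<close> (lemma \<open>variation_control\<close>): in the
  clock \<open>W\<close> both functions are Hoelder continuous, with exponents \<open>1/r\<close> and \<open>1/s\<close>. The discrete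
  Love--Young inequality (\<open>discrete_love_young\<close>) bounds the error made when a left sum over a block
  is replaced by the single term of the block, by a multiple of the power \<open>\<theta>\<close> of the increment of
  \<open>W\<close>, where \<open>\<theta> > 1\<close> is the sum of the exponents; summation over the blocks of a partition costs
  nothing, because \<open>\<theta> \<ge> 1\<close> (\<open>sum_powr_increments_le\<close>). Smallness on fine partitions comes from the
  continuity of \<open>f\<close> rather than from that of \<open>W\<close>: the exponent of \<open>f\<close> is lowered from \<open>1/r\<close>
  to some \<open>\<alpha>\<close> with \<open>\<alpha> + 1/s > 1\<close> still; the spare power of \<open>\<bar>f y - f x\<bar>\<close> is then bounded by the
  modulus of continuity of \<open>f\<close>, which turns into a small Hoelder constant on short intervals
  (\<open>riemann_sums_uniformly_Cauchy\<close>).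
\<close>

section \<open>The discrete Love--Young inequality\<close>

text \<open>
  Let \<open>j\<close> be the last index at which \<open>w\<close> has made at most half of its total increment. Cutting out
  the step from \<open>j\<close> to \<open>j + 1\<close> leaves two shorter pieces, each with at most half of the increment, and
  produces two cross terms of size \<open>M * \<omega> powr (\<alpha> + \<beta>)\<close>. Halving the increment gains the factor
  \<open>2 powr - (\<alpha> + \<beta>)\<close> in each of the two pieces, so the induction closes for a constant with
  \<open>K = 2 powr (1 - (\<alpha> + \<beta>)) * K + 2 * M\<close>. This is solvable with \<open>K \<ge> 0\<close> because \<open>\<alpha> + \<beta> > 1\<close>.
\<close>

lemma discrete_love_young:
  fixes u v w :: "nat \<Rightarrow> real"
  assumes ab: "\<alpha> + \<beta> > 1" "\<alpha> > 0" "\<beta> > 0" and M: "M \<ge> 0" and "i \<le> k"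
    and "\<And>l m. i \<le> l \<Longrightarrow> l \<le> m \<Longrightarrow> m \<le> k \<Longrightarrow> w l \<le> w m"
    and "\<And>l m. i \<le> l \<Longrightarrow> l \<le> m \<Longrightarrow> m \<le> k \<Longrightarrow> \<bar>u m - u l\<bar> \<le> M * (w m - w l) powr \<alpha>"
    and "\<And>l m. i \<le> l \<Longrightarrow> l \<le> m \<Longrightarrow> m \<le> k \<Longrightarrow> \<bar>v m - v l\<bar> \<le> (w m - w l) powr \<beta>"
  shows "\<bar>(\<Sum>l=i..<k. u l * (v (Suc l) - v l)) - u i * (v k - v i)\<bar>
    \<le> 2 * M / (1 - 2 powr (1 - (\<alpha> + \<beta>))) * (w k - w i) powr (\<alpha> + \<beta>)"
  using assms(5-)
proof (induction "k - i" arbitrary: i k rule: less_induct)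
  case less
  note mono = less.prems(2) and U = less.prems(3) and V = less.prems(4)
  define K where "K = 2 * M / (1 - 2 powr (1 - (\<alpha> + \<beta>)))"
  define \<theta> where "\<theta> = \<alpha> + \<beta>"
  define \<omega> where "\<omega> = w k - w i"
  define E where "E a b = (\<Sum>l=a..<b. u l * (v (Suc l) - v l)) - u a * (v b - v a)" for a b
  have lt1: "2 powr (1 - \<theta>) < (1::real)"
    using ab powr_less_mono[of "1 - \<theta>" 0 2] by (simp add: \<theta>_def)
  have K0: "K \<ge> 0" using M lt1 by (simp add: K_def \<theta>_def)
  have \<omega>0: "\<omega> \<ge> 0" using mono[of i k] less.prems(1) by (simp add: \<omega>_def)
  show ?case
  proof (cases "i = k")
    case True
    then show ?thesis by simp
  next
    case False
    with less.prems(1) have ik: "i < k" by simp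
    define J where "J = {j. i \<le> j \<and> j < k \<and> w j - w i \<le> \<omega> / 2}"
    define j where "j = Max J"
    have finJ: "finite J" by (rule finite_subset[of _ "{..<k}"]) (auto simp: J_def)
    have "i \<in> J" using ik \<omega>0 by (simp add: J_def)
    then have "j \<in> J" using finJ Max_in[of J] by (metis empty_iff j_def)
    then have j: "i \<le> j" "j < k" "w j - w i \<le> \<omega> / 2" by (auto simp: J_def)
    \<comment> \<open>By maximality of \<open>j\<close>, more than half of the increment is spent before \<open>Suc j\<close>.\<close>
    have right: "w k - w (Suc j) \<le> \<omega> / 2"
    proof (cases "Suc j = k")
      case True
      then show ?thesis using \<omega>0 by simp
    next
      case False
      have "Suc j \<notin> J" using Max_ge[OF finJ, of "Suc j"] by (auto simp: j_def)
      with False j have "w (Suc j) - w i > \<omega> / 2" by (auto simp: J_def)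
      then show ?thesis by (simp add: \<omega>_def field_simps)
    qed
    have half: "(\<omega> / 2) powr \<theta> = 2 powr (- \<theta>) * \<omega> powr \<theta>"
      using \<omega>0 by (simp add: powr_divide powr_minus divide_simps)
    have piece: "\<bar>E a b\<bar> \<le> K * (2 powr (- \<theta>) * \<omega> powr \<theta>)"
      if "i \<le> a" "a \<le> b" "b \<le> k" "b - a < k - i" "w b - w a \<le> \<omega> / 2" for a b
    proof -
      have "\<bar>E a b\<bar> \<le> K * (w b - w a) powr \<theta>"
        unfolding E_def K_def \<theta>_def
        by (rule less.hyps) (use that in \<open>auto intro!: mono U V\<close>)
      also have "\<dots> \<le> K * (\<omega> / 2) powr \<theta>"
        using that mono[of a b] ab by (intro mult_left_mono powr_mono2 K0) (auto simp: \<theta>_def)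
      finally show ?thesis by (simp only: half)
    qed
    have cross: "\<bar>(u b - u a) * (v d - v c)\<bar> \<le> M * \<omega> powr \<theta>"
      if "i \<le> a" "a \<le> b" "b \<le> k" "i \<le> c" "c \<le> d" "d \<le> k" for a b c d
    proof -
      have sub: "w y - w x \<le> \<omega>" if "i \<le> x" "x \<le> y" "y \<le> k" for x y
        using that mono[of i x] mono[of y k] by (simp add: \<omega>_def)
      have "\<bar>u b - u a\<bar> \<le> M * \<omega> powr \<alpha>"
      proof -
        have "(w b - w a) powr \<alpha> \<le> \<omega> powr \<alpha>"
          using that mono[of a b] sub[of a b] ab by (intro powr_mono2) auto
        then show ?thesis using U[of a b] that mult_left_mono[OF _ M] by fastforce
      qed
      moreover have "\<bar>v d - v c\<bar> \<le> \<omega> powr \<beta>"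
      proof -
        have "(w d - w c) powr \<beta> \<le> \<omega> powr \<beta>"
          using that mono[of c d] sub[of c d] ab by (intro powr_mono2) auto
        then show ?thesis using V[of c d] that by fastforce
      qed
      ultimately have "\<bar>u b - u a\<bar> * \<bar>v d - v c\<bar> \<le> (M * \<omega> powr \<alpha>) * \<omega> powr \<beta>"
        using M by (intro mult_mono) auto
      then show ?thesis by (simp add: abs_mult \<theta>_def powr_add mult_ac)
    qed
    have "(\<Sum>l=i..<k. u l * (v (Suc l) - v l))
        = (\<Sum>l=i..<j. u l * (v (Suc l) - v l)) + u j * (v (Suc j) - v j)
          + (\<Sum>l=Suc j..<k. u l * (v (Suc l) - v l))"
      using j sum.atLeastLessThan_concat[of i j k "\<lambda>l. u l * (v (Suc l) - v l)"]
      by (simp add: sum.atLeast_Suc_lessThan)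
    then have "E i k = E i j + E (Suc j) k + (u j - u i) * (v (Suc j) - v j)
        + (u (Suc j) - u i) * (v k - v (Suc j))"
      by (simp add: E_def algebra_simps)
    moreover have "\<bar>E i j\<bar> \<le> K * (2 powr (- \<theta>) * \<omega> powr \<theta>)"
      "\<bar>E (Suc j) k\<bar> \<le> K * (2 powr (- \<theta>) * \<omega> powr \<theta>)"
      "\<bar>(u j - u i) * (v (Suc j) - v j)\<bar> \<le> M * \<omega> powr \<theta>"
      "\<bar>(u (Suc j) - u i) * (v k - v (Suc j))\<bar> \<le> M * \<omega> powr \<theta>"
      using j right by (auto intro!: piece cross)
    ultimately have "\<bar>E i k\<bar> \<le> (2 * (K * 2 powr (- \<theta>)) + 2 * M) * \<omega> powr \<theta>"
      by (simp add: algebra_simps)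
    also have "2 * (K * 2 powr (- \<theta>)) + 2 * M = K"
    proof -
      have "2 * 2 powr (- \<theta>) = (2::real) powr (1 - \<theta>)"
        by (simp add: powr_diff powr_minus divide_simps)
      moreover have "K * (1 - 2 powr (1 - \<theta>)) = 2 * M"
        using lt1 unfolding K_def \<theta>_def by (subst times_divide_eq_left, subst nonzero_mult_div_cancel_right) auto
      ultimately show ?thesis by (simp add: algebra_simps)
    qed
    finally show ?thesis by (simp add: E_def K_def \<theta>_def \<omega>_def)
  qed
qed


section \<open>Tagged partitions and common refinements\<close>

definition riemann_sum :: "(real \<Rightarrow> real) \<Rightarrow> (real \<Rightarrow> real) \<Rightarrow> nat \<Rightarrow> (nat \<Rightarrow> real) \<Rightarrow> (nat \<Rightarrow> real) \<Rightarrow> real"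
  where "riemann_sum f g N s \<xi> = (\<Sum>i<N. f (\<xi> i) * (g (s (Suc i)) - g (s i)))"

definition fine_tagged :: "real \<Rightarrow> real \<Rightarrow> real \<Rightarrow> nat \<Rightarrow> (nat \<Rightarrow> real) \<Rightarrow> (nat \<Rightarrow> real) \<Rightarrow> bool"
  where "fine_tagged \<delta> a b N s \<xi> \<longleftrightarrow> is_partition a b N s \<and> (\<forall>i<N. s (Suc i) - s i < \<delta>) \<and>
    (\<forall>i<N. \<xi> i \<in> {s i..s (Suc i)})"

lemma fine_tagged_mono: "fine_tagged \<delta> a b N s \<xi> \<Longrightarrow> \<delta> \<le> \<delta>' \<Longrightarrow> fine_tagged \<delta>' a b N s \<xi>"
  unfolding fine_tagged_def by (metis less_le_trans)

lemma is_partition_less: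
  assumes "is_partition a b N s" "i < j" "j \<le> N"
  shows "s i < s j"
  using assms(2,3)
proof (induction j)
  case (Suc j)
  have "s j < s (Suc j)" using assms(1) Suc.prems by (auto simp: is_partition_def)
  then show ?case using Suc by (cases "i = j") auto
qed simp

lemma is_partition_mono:
  assumes "is_partition a b N s" "i \<le> j" "j \<le> N"
  shows "s i \<le> s j"
  using is_partition_less[OF assms(1), of i j] assms(2,3) by (cases "i = j") auto

lemma is_partition_in:
  assumes "is_partition a b N s" "i \<le> N"
  shows "a \<le> s i" "s i \<le> b"
  using is_partition_mono[OF assms(1), of 0 i] is_partition_mono[OF assms(1), of i N] assms
  by (auto simp: is_partition_def)

text \<open>
  The points of a strictly increasing sequence determine their indices, so a coarser partition is a
  subsequence of a finer one with the same endpoints. In this form, sums over the finer partition can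
  be split into blocks of indices.
\<close>

lemma is_partition_subsequence:
  assumes P: "is_partition a b N s" and R: "is_partition a b n x" and sub: "s ` {..N} \<subseteq> x ` {..n}"
  obtains \<phi> where "\<phi> 0 = 0" "\<phi> N = n" "\<And>j. j < N \<Longrightarrow> \<phi> j \<le> \<phi> (Suc j)" "\<And>j. j \<le> N \<Longrightarrow> \<phi> j \<le> n"
    "\<And>j. j \<le> N \<Longrightarrow> x (\<phi> j) = s j"
proof -
  have "\<forall>j. \<exists>l. j \<le> N \<longrightarrow> l \<le> n \<and> x l = s j" using sub by fastforce
  then obtain \<phi> where \<phi>: "\<And>j. j \<le> N \<Longrightarrow> \<phi> j \<le> n \<and> x (\<phi> j) = s j" by metis
  have inj: "l = m" if "l \<le> n" "m \<le> n" "x l = x m" for l m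
    using that is_partition_less[OF R, of l m] is_partition_less[OF R, of m l] by (cases l m rule: linorder_cases) auto
  show ?thesis
  proof (rule that[of \<phi>])
    show "\<phi> 0 = 0" using \<phi>[of 0] P R inj[of "\<phi> 0" 0] by (auto simp: is_partition_def)
    show "\<phi> N = n" using \<phi>[of N] P R inj[of "\<phi> N" n] by (auto simp: is_partition_def)
    show "\<phi> j \<le> \<phi> (Suc j)" if "j < N" for j
    proof (rule ccontr)
      assume "\<not> \<phi> j \<le> \<phi> (Suc j)"
      then have "x (\<phi> (Suc j)) < x (\<phi> j)"
        using \<phi>[of j] that by (intro is_partition_less[OF R]) auto
      then show False using \<phi>[of j] \<phi>[of "Suc j"] that P by (auto simp: is_partition_def)
    qed
  qed (use \<phi> in auto)
qed

lemma common_refinement: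
  assumes P: "is_partition a b N s" and Q: "is_partition a b N' s'"
  obtains n x where "is_partition a b n x" "s ` {..N} \<subseteq> x ` {..n}" "s' ` {..N'} \<subseteq> x ` {..n}"
proof -
  define A where "A = s ` {..N} \<union> s' ` {..N'}"
  define xs where "xs = sorted_list_of_set A"
  have finA: "finite A" by (simp add: A_def)
  have set: "set xs = A" using finA by (simp add: xs_def)
  have sorted: "sorted_wrt (<) xs" by (simp add: xs_def)
  have aA: "a \<in> A" and bA: "b \<in> A" using P by (force simp: A_def is_partition_def)+
  have bounds: "a \<le> y \<and> y \<le> b" if "y \<in> A" for y
    using that is_partition_in[OF P] is_partition_in[OF Q] by (auto simp: A_def)
  have len: "length xs > 0" using aA set by (metis empty_iff length_greater_0_conv list.set(1))
  define n where "n = length xs - 1"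
  define x where "x = (\<lambda>i. xs ! i)"
  have less: "xs ! i < xs ! j" if "i < j" "j < length xs" for i j
    using sorted that by (simp add: sorted_wrt_iff_nth_less)
  have n: "Suc n = length xs" using len by (simp add: n_def)
  have img: "x ` {..n} = A"
  proof -
    have "{..n} = {..<length xs}" using n by (metis lessThan_Suc_atMost)
    then show ?thesis using set by (auto simp: x_def set_conv_nth image_def)
  qed
  have "is_partition a b n x"
    unfolding is_partition_def
  proof (intro conjI allI impI)
    obtain i where i: "i \<le> n" "x i = a" using aA img by (metis atMost_iff imageE)
    have "a \<le> x 0" using bounds img by auto
    then show "x 0 = a"
      using less[of 0 i] i n by (cases "i = 0") (auto simp: x_def)
    obtain k where k: "k \<le> n" "x k = b" using bA img by (metis atMost_iff imageE)
    have "x n \<le> b" using bounds img by auto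
    then show "x n = b" using less[of k n] k n by (cases "k = n") (auto simp: x_def)
    show "x i < x (Suc i)" if "i < n" for i using that less[of i "Suc i"] by (simp add: x_def n_def)
  qed
  then show ?thesis using img by (intro that) (auto simp: A_def)
qed


section \<open>Riemann--Stieltjes sums under a control\<close>

text \<open>
  Hoelder continuity with exponent \<open>\<alpha>\<close> and constant \<open>M\<close> in the clock \<open>W\<close>, required only on
  intervals shorter than \<open>\<delta>\<close>: there the constant can be made small, which it cannot be globally.
\<close>

definition controlled :: "(real \<Rightarrow> real) \<Rightarrow> real \<Rightarrow> real \<Rightarrow> real \<Rightarrow> (real \<Rightarrow> real) \<Rightarrow> bool"
  where "controlled W \<delta> M \<alpha> f \<longleftrightarrow>
    (\<forall>x y. 0 \<le> x \<and> x \<le> y \<and> y \<le> 1 \<and> y - x < \<delta> \<longrightarrow> \<bar>f y - f x\<bar> \<le> M * (W y - W x) powr \<alpha>)"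

lemma controlledD:
  "controlled W \<delta> M \<alpha> f \<Longrightarrow> 0 \<le> x \<Longrightarrow> x \<le> y \<Longrightarrow> y \<le> 1 \<Longrightarrow> y - x < \<delta> \<Longrightarrow>
    \<bar>f y - f x\<bar> \<le> M * (W y - W x) powr \<alpha>"
  by (auto simp: controlled_def)

lemma sum_blocks:
  fixes h :: "nat \<Rightarrow> real"
  assumes "\<phi> 0 = 0" "\<And>j. j < N \<Longrightarrow> \<phi> j \<le> \<phi> (Suc j)"
  shows "(\<Sum>l<\<phi> N. h l) = (\<Sum>j<N. \<Sum>l=\<phi> j..<\<phi> (Suc j). h l)"
  using assms(2)
proof (induction N)
  case (Suc N)
  have "(\<Sum>l<\<phi> (Suc N). h l) = (\<Sum>l<\<phi> N. h l) + (\<Sum>l=\<phi> N..<\<phi> (Suc N). h l)"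
    using sum.atLeastLessThan_concat[of 0 "\<phi> N" "\<phi> (Suc N)" h] Suc.prems by (simp add: atLeast0LessThan)
  then show ?case using Suc by simp
qed (use assms in simp)

text \<open>
  Superadditivity of \<open>x \<mapsto> x powr \<theta>\<close>: split the power \<open>\<theta> - 1\<close> off each summand, bound it by
  that power of the total increment, and telescope.
\<close>

lemma sum_powr_increments_le:
  fixes w :: "nat \<Rightarrow> real"
  assumes mono: "\<And>j. j < N \<Longrightarrow> w j \<le> w (Suc j)" and \<theta>: "\<theta> \<ge> 1"
  shows "(\<Sum>j<N. (w (Suc j) - w j) powr \<theta>) \<le> (w N - w 0) powr \<theta>"
proof -
  have le: "w j \<le> w k" if "j \<le> k" "k \<le> N" for j k
    using that by (induction k) (auto simp: le_Suc_eq intro: order_trans[OF _ mono])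
  have "(w (Suc j) - w j) powr \<theta> \<le> (w N - w 0) powr (\<theta> - 1) * (w (Suc j) - w j)" if "j < N" for j
  proof -
    have d: "0 \<le> w (Suc j) - w j" "w (Suc j) - w j \<le> w N - w 0"
      using that le[of j "Suc j"] le[of 0 j] le[of "Suc j" N] by auto
    have "(w (Suc j) - w j) powr \<theta> = (w (Suc j) - w j) powr (\<theta> - 1) * (w (Suc j) - w j)"
      using d powr_add[of "w (Suc j) - w j" "\<theta> - 1" 1] by simp
    also have "\<dots> \<le> (w N - w 0) powr (\<theta> - 1) * (w (Suc j) - w j)"
      using d \<theta> by (intro mult_right_mono powr_mono2) auto
    finally show ?thesis .
  qed
  then have "(\<Sum>j<N. (w (Suc j) - w j) powr \<theta>)
      \<le> (\<Sum>j<N. (w N - w 0) powr (\<theta> - 1) * (w (Suc j) - w j))"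
    by (intro sum_mono) auto
  also have "\<dots> = (w N - w 0) powr (\<theta> - 1) * (w N - w 0)"
    by (simp add: sum_distrib_left[symmetric] sum_lessThan_telescope)
  also have "\<dots> = (w N - w 0) powr \<theta>"
    using le[of 0 N] powr_add[of "w N - w 0" "\<theta> - 1" 1] by simp
  finally show ?thesis .
qed

text \<open>
  The fine sum is compared with the coarse one block by block, a block being the set of fine points
  between two consecutive coarse points. Within a block the Love--Young inequality compares the fine
  sum with the left-tagged coarse term, and moving the tag costs one more product of increments, which
  accounts for the summand \<open>1\<close> in the constant. All points of a block are within \<open>\<delta>\<close> of each
  other, so the local control suffices, and the bound is proportional to \<open>M\<close>.
\<close>

lemma riemann_sum_refinement:
  assumes ab: "\<alpha> + \<beta> > 1" "\<alpha> > 0" "\<beta> > 0" and M: "M \<ge> 0"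
    and W: "mono_on {0..1} W"
    and f: "controlled W \<delta> M \<alpha> f" and g: "controlled W \<delta> 1 \<beta> g"
    and P: "fine_tagged \<delta> 0 t N s \<xi>" and R: "is_partition 0 t n x" and t: "t \<le> 1"
    and sub: "s ` {..N} \<subseteq> x ` {..n}"
  shows "\<bar>riemann_sum f g n x x - riemann_sum f g N s \<xi>\<bar>
    \<le> M * (2 / (1 - 2 powr (1 - (\<alpha> + \<beta>))) + 1) * (W 1 - W 0) powr (\<alpha> + \<beta>)"
proof -
  define C where "C = 2 / (1 - 2 powr (1 - (\<alpha> + \<beta>)))"
  define \<theta> where "\<theta> = \<alpha> + \<beta>"
  define h where "h l = f (x l) * (g (x (Suc l)) - g (x l))" for l
  have lt1: "2 powr (1 - \<theta>) < (1::real)"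
    using ab powr_less_mono[of "1 - \<theta>" 0 2] by (simp add: \<theta>_def)
  have C0: "C \<ge> 0" using lt1 by (simp add: C_def \<theta>_def)
  have p: "is_partition 0 t N s" and mesh: "\<And>j. j < N \<Longrightarrow> s (Suc j) - s j < \<delta>"
    and tag: "\<And>j. j < N \<Longrightarrow> \<xi> j \<in> {s j..s (Suc j)}"
    using P by (auto simp: fine_tagged_def)
  obtain \<phi> where \<phi>: "\<phi> 0 = 0" "\<phi> N = n" "\<And>j. j < N \<Longrightarrow> \<phi> j \<le> \<phi> (Suc j)"
    "\<And>j. j \<le> N \<Longrightarrow> \<phi> j \<le> n" "\<And>j. j \<le> N \<Longrightarrow> x (\<phi> j) = s j"
    using is_partition_subsequence[OF p R sub] by blast
  have W': "W y \<le> W z" if "0 \<le> y" "y \<le> z" "z \<le> 1" for y z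
    using W that by (auto simp: mono_on_def)
  note sin = is_partition_in[OF p] and xin = is_partition_in[OF R]
  have block: "\<bar>(\<Sum>l=\<phi> j..<\<phi> (Suc j). h l) - f (\<xi> j) * (g (s (Suc j)) - g (s j))\<bar>
      \<le> M * (C + 1) * (W (s (Suc j)) - W (s j)) powr \<theta>" if j: "j < N" for j
  proof -
    define \<omega> where "\<omega> = W (s (Suc j)) - W (s j)"
    have s01: "0 \<le> s j" "s j \<le> s (Suc j)" "s (Suc j) \<le> 1"
      using sin[of j] sin[of "Suc j"] is_partition_mono[OF p, of j "Suc j"] j t by auto
    have pts: "0 \<le> x l \<and> x l \<le> x m \<and> x m \<le> 1 \<and> x m - x l < \<delta>"
      if "\<phi> j \<le> l" "l \<le> m" "m \<le> \<phi> (Suc j)" for l m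
    proof -
      have mn: "m \<le> n" using that \<phi>(4)[of "Suc j"] j by simp
      have "s j \<le> x l" "x l \<le> x m" "x m \<le> s (Suc j)"
        using is_partition_mono[OF R] that mn \<phi>(5)[of j] \<phi>(5)[of "Suc j"] \<phi>(4)[of "Suc j"] j
        by (metis Suc_leI less_imp_le order_trans)+
      then show ?thesis using s01 mesh[OF j] by auto
    qed
    have "\<bar>(\<Sum>l=\<phi> j..<\<phi> (Suc j). f (x l) * (g (x (Suc l)) - g (x l)))
        - f (x (\<phi> j)) * (g (x (\<phi> (Suc j))) - g (x (\<phi> j)))\<bar>
      \<le> 2 * M / (1 - 2 powr (1 - (\<alpha> + \<beta>))) * (W (x (\<phi> (Suc j))) - W (x (\<phi> j))) powr (\<alpha> + \<beta>)"
    proof (rule discrete_love_young[where u = "\<lambda>l. f (x l)" and v = "\<lambda>l. g (x l)" and w = "\<lambda>l. W (x l)"])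
      show "\<bar>g (x m) - g (x l)\<bar> \<le> (W (x m) - W (x l)) powr \<beta>"
        if "\<phi> j \<le> l" "l \<le> m" "m \<le> \<phi> (Suc j)" for l m
        using controlledD[OF g] pts[OF that] by fastforce
    qed (use ab M \<phi>(3)[OF j] pts W' controlledD[OF f] in auto)
    then have 1: "\<bar>(\<Sum>l=\<phi> j..<\<phi> (Suc j). h l) - f (s j) * (g (s (Suc j)) - g (s j))\<bar> \<le> M * C * \<omega> powr \<theta>"
      using \<phi>(5)[of j] \<phi>(5)[of "Suc j"] j by (simp add: h_def C_def \<theta>_def \<omega>_def mult_ac)
    have 2: "\<bar>(f (\<xi> j) - f (s j)) * (g (s (Suc j)) - g (s j))\<bar> \<le> M * \<omega> powr \<theta>"
    proof -
      have \<xi>: "s j \<le> \<xi> j" "\<xi> j \<le> s (Suc j)" using tag[OF j] by auto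
      have "\<bar>f (\<xi> j) - f (s j)\<bar> \<le> M * (W (\<xi> j) - W (s j)) powr \<alpha>"
        using \<xi> s01 mesh[OF j] by (intro controlledD[OF f]) auto
      also have "\<dots> \<le> M * \<omega> powr \<alpha>"
        using \<xi> s01 ab W'[of "s j" "\<xi> j"] W'[of "\<xi> j" "s (Suc j)"]
        by (intro mult_left_mono powr_mono2 M) (auto simp: \<omega>_def)
      finally have a: "\<bar>f (\<xi> j) - f (s j)\<bar> \<le> M * \<omega> powr \<alpha>" .
      have b: "\<bar>g (s (Suc j)) - g (s j)\<bar> \<le> \<omega> powr \<beta>"
        using controlledD[OF g, of "s j" "s (Suc j)"] s01 mesh[OF j] by (simp add: \<omega>_def)
      have "\<bar>f (\<xi> j) - f (s j)\<bar> * \<bar>g (s (Suc j)) - g (s j)\<bar> \<le> (M * \<omega> powr \<alpha>) * \<omega> powr \<beta>"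
        using M by (intro mult_mono a b) auto
      then show ?thesis by (simp add: abs_mult \<theta>_def powr_add mult_ac)
    qed
    have "\<bar>(\<Sum>l=\<phi> j..<\<phi> (Suc j). h l) - f (\<xi> j) * (g (s (Suc j)) - g (s j))\<bar>
        \<le> M * C * \<omega> powr \<theta> + M * \<omega> powr \<theta>"
      using 1 2 by (simp add: algebra_simps)
    then show ?thesis by (simp add: \<omega>_def algebra_simps)
  qed
  have "riemann_sum f g n x x - riemann_sum f g N s \<xi>
      = (\<Sum>j<N. (\<Sum>l=\<phi> j..<\<phi> (Suc j). h l) - f (\<xi> j) * (g (s (Suc j)) - g (s j)))"
    using sum_blocks[of \<phi> N h] \<phi> by (simp add: riemann_sum_def h_def sum_subtractf)
  also have "\<bar>\<dots>\<bar> \<le> (\<Sum>j<N. M * (C + 1) * (W (s (Suc j)) - W (s j)) powr \<theta>)"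
    by (rule order_trans[OF sum_abs]) (intro sum_mono block, simp)
  also have "\<dots> = M * (C + 1) * (\<Sum>j<N. (W (s (Suc j)) - W (s j)) powr \<theta>)"
    by (simp add: sum_distrib_left)
  also have "\<dots> \<le> M * (C + 1) * (W (s N) - W (s 0)) powr \<theta>"
  proof (intro mult_left_mono sum_powr_increments_le)
    show "W (s j) \<le> W (s (Suc j))" if "j < N" for j
      using sin[of j] sin[of "Suc j"] is_partition_mono[OF p, of j "Suc j"] that t by (intro W') auto
  qed (use ab M C0 in \<open>auto simp: \<theta>_def\<close>)
  also have "\<dots> \<le> M * (C + 1) * (W 1 - W 0) powr \<theta>"
  proof -
    have "s N = t" "s 0 = 0" "0 \<le> t" using p sin[of N] by (auto simp: is_partition_def)
    then have "(W (s N) - W (s 0)) powr \<theta> \<le> (W 1 - W 0) powr \<theta>"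
      using W'[of 0 t] W'[of t 1] t ab by (intro powr_mono2) (auto simp: \<theta>_def)
    then show ?thesis using M C0 by (intro mult_left_mono) auto
  qed
  finally show ?thesis by (simp add: C_def \<theta>_def)
qed


section \<open>The variation function as a control\<close>

definition partition_power_sum :: "real \<Rightarrow> (real \<Rightarrow> real) \<Rightarrow> nat \<Rightarrow> (nat \<Rightarrow> real) \<Rightarrow> real"
  where "partition_power_sum r f N s = (\<Sum>i<N. \<bar>f (s (Suc i)) - f (s i)\<bar> powr r)"

definition variation_upto :: "real \<Rightarrow> (real \<Rightarrow> real) \<Rightarrow> real \<Rightarrow> real"
  where "variation_upto r f t = (SUP (N, s) \<in> {(N, s). is_partition 0 t N s}. partition_power_sum r f N s)"

lemma is_partition_snoc:
  assumes "is_partition a b N s" "b < c"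
  shows "is_partition a c (Suc N) (s(Suc N := c))"
  using assms by (auto simp: is_partition_def less_Suc_eq)

lemma partition_power_sum_snoc:
  assumes "is_partition a b N s"
  shows "partition_power_sum r f (Suc N) (s(Suc N := c)) = partition_power_sum r f N s + \<bar>f c - f b\<bar> powr r"
  using assms by (auto simp: partition_power_sum_def is_partition_def intro!: sum.cong)

text \<open>
  The function \<open>V t\<close> is the supremum of the power sums over partitions of \<open>[0,t]\<close>. Appending \<open>y\<close> to a
  partition of \<open>[0,x]\<close> adds exactly \<open>\<bar>f y - f x\<bar> powr r\<close> to its power sum, hence the increment
  bound; appending \<open>1\<close> to a partition of \<open>[0,t]\<close> shows that the suprema are finite. Working with
  intervals that start at \<open>0\<close> makes the control \<open>V y - V x\<close> additive.
\<close>

lemma variation_control: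
  assumes fin: "has_finite_variation r f" and r: "r > 0"
  obtains V where "mono_on {0..1} V"
    "\<And>x y. 0 \<le> x \<Longrightarrow> x \<le> y \<Longrightarrow> y \<le> 1 \<Longrightarrow> \<bar>f y - f x\<bar> powr r \<le> V y - V x"
proof -
  define B where "B = enn2real (variation r f)"
  have full: "partition_power_sum r f N s \<le> B" if "is_partition 0 1 N s" for N s
  proof -
    have "ennreal (\<Sum>i=1..N. \<bar>f (s i) - f (s (i - 1))\<bar> powr r) \<le> variation r f"
      unfolding variation_def using that by (intro SUP_upper2[of "(N, s)"]) auto
    also have "(\<Sum>i=1..N. \<bar>f (s i) - f (s (i - 1))\<bar> powr r) = partition_power_sum r f N s"
      unfolding partition_power_sum_def by (rule sum.reindex_bij_witness[of _ Suc "\<lambda>i. i - 1"]) auto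
    finally have "enn2real (ennreal (partition_power_sum r f N s)) \<le> B"
      using fin unfolding B_def has_finite_variation_def by (intro enn2real_mono) auto
    moreover have "partition_power_sum r f N s \<ge> 0" by (simp add: partition_power_sum_def sum_nonneg)
    ultimately show ?thesis by simp
  qed
  have bound: "partition_power_sum r f N s \<le> B" if "is_partition 0 t N s" "t \<le> 1" for t N s
  proof (cases "t = 1")
    case False
    then have "t < 1" using that by simp
    from full[OF is_partition_snoc[OF that(1) this]] partition_power_sum_snoc[OF that(1), of r f 1]
    show ?thesis by (smt (verit) powr_ge_zero)
  qed (use full that in auto)
  define V where "V = variation_upto r f"
  have bdd: "bdd_above ((\<lambda>(N, s). partition_power_sum r f N s) ` {(N, s). is_partition 0 t N s})"
    if "t \<le> 1" for t
    using bound[OF _ that] by (intro bdd_aboveI[of _ B]) auto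
  have incr: "\<bar>f y - f x\<bar> powr r \<le> V y - V x" if "0 \<le> x" "x \<le> y" "y \<le> 1" for x y
  proof (cases "x = y")
    case True
    then show ?thesis using r by simp
  next
    case False
    with that have "x < y" by simp
    have "V x \<le> V y - \<bar>f y - f x\<bar> powr r"
      unfolding V_def variation_upto_def[of r f x]
    proof (rule cSUP_least)
      show "{(N, s). is_partition 0 x N s} \<noteq> {}"
        using fine_partition_exists[OF that(1), of 1] by auto
      fix Ns assume "Ns \<in> {(N, s). is_partition 0 x N s}"
      then obtain N s where Ns: "Ns = (N, s)" "is_partition 0 x N s" by auto
      have "partition_power_sum r f (Suc N) (s(Suc N := y)) \<le> variation_upto r f y"
        unfolding variation_upto_def
        using is_partition_snoc[OF Ns(2) \<open>x < y\<close>] by (intro cSUP_upper2[OF bdd[OF that(3)], of "(Suc N, s(Suc N := y))"]) auto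
      then show "(case Ns of (N, s) \<Rightarrow> partition_power_sum r f N s) \<le> variation_upto r f y - \<bar>f y - f x\<bar> powr r"
        using partition_power_sum_snoc[OF Ns(2), of r f y] Ns(1) by simp
    qed
    then show ?thesis by simp
  qed
  moreover have "mono_on {0..1} V"
  proof (rule mono_onI)
    fix x y :: real assume "x \<in> {0..1}" "y \<in> {0..1}" "x \<le> y"
    then show "V x \<le> V y" using incr[of x y] by (smt (verit) atLeastAtMost_iff powr_ge_zero)
  qed
  ultimately show ?thesis using that by blast
qed


section \<open>The indefinite Young integral\<close>

text \<open>
  With \<open>\<beta> = 1/s\<close> and \<open>1 - \<beta> < \<alpha> < 1/r\<close>, write the increment \<open>d = \<bar>f y - f x\<bar>\<close> as
  \<open>d powr (1 - \<alpha> * r) * (d powr r) powr \<alpha>\<close>. The second factor is controlled by \<open>W\<close>; the first tends to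
  zero with \<open>y - x\<close> by uniform continuity of \<open>f\<close>, so \<open>f\<close> is controlled with an arbitrarily small
  constant on short intervals. Two fine sums are then compared through a common refinement. None of the
  bounds depends on \<open>t\<close>.
\<close>

lemma riemann_sums_uniformly_Cauchy:
  assumes f: "continuous_on {0..1} f" and r: "r \<ge> 1" and s: "s \<ge> 1" and rs: "1 / r + 1 / s > 1"
    and var: "has_finite_variation r f" "has_finite_variation s g" and \<epsilon>: "\<epsilon> > 0"
  obtains \<delta> where "\<delta> > 0"
    "\<And>t N s \<xi> N' s' \<xi>'. t \<le> 1 \<Longrightarrow> fine_tagged \<delta> 0 t N s \<xi> \<Longrightarrow> fine_tagged \<delta> 0 t N' s' \<xi>' \<Longrightarrow>
      \<bar>riemann_sum f g N s \<xi> - riemann_sum f g N' s' \<xi>'\<bar> < \<epsilon>"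
proof -
  obtain Vf where Vf: "mono_on {0..1} Vf"
    "\<And>x y. 0 \<le> x \<Longrightarrow> x \<le> y \<Longrightarrow> y \<le> 1 \<Longrightarrow> \<bar>f y - f x\<bar> powr r \<le> Vf y - Vf x"
    using variation_control[OF var(1)] r by auto
  obtain Vg where Vg: "mono_on {0..1} Vg"
    "\<And>x y. 0 \<le> x \<Longrightarrow> x \<le> y \<Longrightarrow> y \<le> 1 \<Longrightarrow> \<bar>g y - g x\<bar> powr s \<le> Vg y - Vg x"
    using variation_control[OF var(2)] s by auto
  define W where "W x = Vf x + Vg x" for x
  have W: "mono_on {0..1} W"
    using Vf(1) Vg(1) by (auto simp: mono_on_def W_def intro: add_mono)
  have Wf: "\<bar>f y - f x\<bar> powr r \<le> W y - W x" and Wg: "\<bar>g y - g x\<bar> powr s \<le> W y - W x"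
    if "0 \<le> x" "x \<le> y" "y \<le> 1" for x y
    using Vf(2)[OF that] Vg(2)[OF that] powr_ge_zero[of "\<bar>f y - f x\<bar>" r] powr_ge_zero[of "\<bar>g y - g x\<bar>" s]
    unfolding W_def by linarith+
  define \<beta> where "\<beta> = 1 / s"
  \<comment> \<open>The midpoint of the nonempty interval from \<open>1 - \<beta>\<close> to \<open>1 / r\<close>.\<close>
  define \<alpha> where "\<alpha> = (1 / r + (1 - \<beta>)) / 2"
  have \<beta>: "0 < \<beta>" "\<beta> \<le> 1" using s by (auto simp: \<beta>_def)
  have "1 / r > 0" using r by simp
  then have \<alpha>: "\<alpha> > 0" "\<alpha> < 1 / r" "\<alpha> + \<beta> > 1"
    using rs \<beta> unfolding \<alpha>_def \<beta>_def[symmetric] by argo+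
  have \<alpha>r: "1 - \<alpha> * r > 0" using \<alpha>(2) r by (simp add: field_simps)
  define L where "L = (2 / (1 - 2 powr (1 - (\<alpha> + \<beta>))) + 1) * (W 1 - W 0) powr (\<alpha> + \<beta>)"
  have "2 powr (1 - (\<alpha> + \<beta>)) < (1::real)"
    using \<alpha> powr_less_mono[of "1 - (\<alpha> + \<beta>)" 0 2] by simp
  then have L0: "L \<ge> 0" by (simp add: L_def)
  \<comment> \<open>Each of the two comparisons with the refinement costs at most \<open>M * L\<close>, and \<open>\<eta>\<close> is the
    oscillation of \<open>f\<close> for which the Hoelder constant becomes \<open>M\<close>. The summand \<open>1\<close> keeps \<open>M\<close>
    positive when \<open>L = 0\<close>.\<close>
  define M where "M = \<epsilon> / (2 * (L + 1))"
  have M: "M > 0" using \<epsilon> L0 by (simp add: M_def)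
  have M_times_L: "M * L < \<epsilon> / 2"
    using \<epsilon> L0 by (simp add: M_def field_simps)
  define \<eta> where "\<eta> = M powr (1 / (1 - \<alpha> * r))"
  have \<eta>: "\<eta> > 0" "\<eta> powr (1 - \<alpha> * r) = M"
    using M \<alpha>r by (auto simp: \<eta>_def powr_powr)
  obtain \<delta> where \<delta>: "\<delta> > 0" "\<And>x y. x \<in> {0..1} \<Longrightarrow> y \<in> {0..1} \<Longrightarrow> dist y x < \<delta> \<Longrightarrow> dist (f y) (f x) < \<eta>"
    using compact_uniformly_continuous[OF f] \<eta>(1) unfolding uniformly_continuous_on_def by auto
  have cf: "controlled W \<delta> M \<alpha> f"
    unfolding controlled_def
  proof (intro allI impI, elim conjE)
    fix x y :: real assume xy: "0 \<le> x" "x \<le> y" "y \<le> 1" "y - x < \<delta>"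
    define d where "d = \<bar>f y - f x\<bar>"
    have "d < \<eta>" using \<delta>(2)[of x y] xy by (auto simp: d_def dist_real_def)
    have "d = d powr (1 - \<alpha> * r) * (d powr r) powr \<alpha>"
      using powr_add[of d "1 - \<alpha> * r" "r * \<alpha>"] by (simp add: powr_powr mult.commute d_def)
    also have "\<dots> \<le> \<eta> powr (1 - \<alpha> * r) * (W y - W x) powr \<alpha>"
      using \<open>d < \<eta>\<close> Wf[OF xy(1-3)] \<alpha> \<alpha>r
      by (intro mult_mono powr_mono2) (auto simp: d_def)
    finally show "\<bar>f y - f x\<bar> \<le> M * (W y - W x) powr \<alpha>" by (simp add: \<eta>(2) d_def)
  qed
  have cg: "controlled W \<delta> 1 \<beta> g"
    unfolding controlled_def
  proof (intro allI impI, elim conjE)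
    fix x y :: real assume xy: "0 \<le> x" "x \<le> y" "y \<le> 1"
    have "\<bar>g y - g x\<bar> = (\<bar>g y - g x\<bar> powr s) powr \<beta>"
      using s by (simp add: powr_powr \<beta>_def)
    also have "\<dots> \<le> (W y - W x) powr \<beta>"
      using Wg[OF xy] \<beta> by (intro powr_mono2) auto
    finally show "\<bar>g y - g x\<bar> \<le> 1 * (W y - W x) powr \<beta>" by simp
  qed
  show ?thesis
  proof (rule that[OF \<delta>(1)])
    fix t N s \<xi> N' s' \<xi>'
    assume t: "t \<le> 1" and P: "fine_tagged \<delta> 0 t N s \<xi>" and Q: "fine_tagged \<delta> 0 t N' s' \<xi>'"
    obtain n x where x: "is_partition 0 t n x" "s ` {..N} \<subseteq> x ` {..n}" "s' ` {..N'} \<subseteq> x ` {..n}"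
      using common_refinement P Q unfolding fine_tagged_def by metis
    note refine = riemann_sum_refinement[OF \<alpha>(3) \<alpha>(1) \<beta>(1) less_imp_le[OF M] W cf cg _ x(1) t]
    have "\<bar>riemann_sum f g n x x - riemann_sum f g N s \<xi>\<bar> \<le> M * L"
      "\<bar>riemann_sum f g n x x - riemann_sum f g N' s' \<xi>'\<bar> \<le> M * L"
      using refine[OF P x(2)] refine[OF Q x(3)] by (simp_all add: L_def mult.assoc)
    then show "\<bar>riemann_sum f g N s \<xi> - riemann_sum f g N' s' \<xi>'\<bar> < \<epsilon>"
      using M_times_L by linarith
  qed
qed

lemma has_young_integral_iff_fine_tagged:
  "has_young_integral f g a b I \<longleftrightarrow>
    (\<forall>\<epsilon>>0. \<exists>\<delta>>0. \<forall>N s \<xi>. fine_tagged \<delta> a b N s \<xi> \<longrightarrow> \<bar>riemann_sum f g N s \<xi> - I\<bar> < \<epsilon>)"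
  by (simp add: has_young_integral_def fine_tagged_def riemann_sum_def)

text \<open>
  The uniform Cauchy property yields the limit along a chosen sequence of partitions with mesh below
  \<open>1 / (n + 1)\<close>, and then transfers it to all fine tagged partitions, with the same \<open>\<delta>\<close> for every \<open>t\<close>.
\<close>

lemma young_integral_uniform_limit:
  assumes f: "continuous_on {0..1} f" and r: "r \<ge> 1" and s: "s \<ge> 1" and rs: "1 / r + 1 / s > 1"
    and var: "has_finite_variation r f" "has_finite_variation s g"
  obtains I where "\<And>\<epsilon>. \<epsilon> > 0 \<Longrightarrow> \<exists>\<delta>>0. \<forall>t\<in>{0..1}. \<forall>N s \<xi>. fine_tagged \<delta> 0 t N s \<xi> \<longrightarrow>
    \<bar>riemann_sum f g N s \<xi> - I t\<bar> < \<epsilon>"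
proof -
  have "\<exists>N s. fine_tagged (1 / real (Suc n)) 0 t N s s" if "t \<ge> 0" for n and t :: real
  proof -
    obtain N s where "is_partition 0 t N s" "\<forall>i<N. s (Suc i) - s i < 1 / real (Suc n)"
      using fine_partition_exists[OF \<open>t \<ge> 0\<close>, of "1 / real (Suc n)"] by auto
    then have "fine_tagged (1 / real (Suc n)) 0 t N s s"
      by (simp add: fine_tagged_def is_partition_def less_imp_le)
    then show ?thesis by blast
  qed
  then have "\<forall>n t. \<exists>N s. t \<ge> 0 \<longrightarrow> fine_tagged (1 / real (Suc n)) 0 t N s s" by blast
  then obtain N s where P: "\<And>n t. t \<ge> 0 \<Longrightarrow> fine_tagged (1 / real (Suc n)) 0 t (N n t) (s n t) (s n t)"
    by metis
  define X where "X n t = riemann_sum f g (N n t) (s n t) (s n t)" for n t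
  have tail: "\<exists>n0. \<forall>n\<ge>n0. \<forall>t\<ge>0. fine_tagged \<delta> 0 t (N n t) (s n t) (s n t)" if "\<delta> > 0" for \<delta>
  proof -
    obtain n0 where n0: "1 / real (Suc n0) < \<delta>" using nat_approx_posE[OF \<open>\<delta> > 0\<close>] by metis
    have "fine_tagged \<delta> 0 t (N n t) (s n t) (s n t)" if "n \<ge> n0" "t \<ge> 0" for n t
    proof -
      have "1 / real (Suc n) \<le> 1 / real (Suc n0)" using that by (intro divide_left_mono) auto
      with n0 show ?thesis by (intro fine_tagged_mono[OF P[OF that(2), of n]]) simp
    qed
    then show ?thesis by blast
  qed
  define I where "I t = lim (\<lambda>n. X n t)" for t
  have lim: "(\<lambda>n. X n t) \<longlonglongrightarrow> I t" if t: "t \<in> {0..1}" for t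
  proof -
    have "Cauchy (\<lambda>n. X n t)"
    proof (rule metric_CauchyI)
      fix \<epsilon> :: real assume "\<epsilon> > 0"
      from riemann_sums_uniformly_Cauchy[OF f r s rs var this] obtain \<delta> where "\<delta> > 0"
        and \<delta>: "\<And>t N s \<xi> N' s' \<xi>'. t \<le> 1 \<Longrightarrow> fine_tagged \<delta> 0 t N s \<xi> \<Longrightarrow> fine_tagged \<delta> 0 t N' s' \<xi>' \<Longrightarrow>
          \<bar>riemann_sum f g N s \<xi> - riemann_sum f g N' s' \<xi>'\<bar> < \<epsilon>" by blast
      obtain n0 where "\<And>n. n \<ge> n0 \<Longrightarrow> fine_tagged \<delta> 0 t (N n t) (s n t) (s n t)"
        using tail[OF \<open>\<delta> > 0\<close>] t by auto
      then have "dist (X m t) (X n t) < \<epsilon>" if "m \<ge> n0" "n \<ge> n0" for m n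
        unfolding X_def dist_real_def using that t by (intro \<delta>[of t]) auto
      then show "\<exists>n0. \<forall>m\<ge>n0. \<forall>n\<ge>n0. dist (X m t) (X n t) < \<epsilon>" by blast
    qed
    then show ?thesis by (simp add: I_def Cauchy_convergent_iff convergent_LIMSEQ_iff)
  qed
  show ?thesis
  proof (rule that[of I])
    fix \<epsilon> :: real assume "\<epsilon> > 0"
    then have "\<epsilon> / 2 > 0" by simp
    from riemann_sums_uniformly_Cauchy[OF f r s rs var this] obtain \<delta> where "\<delta> > 0"
      and \<delta>: "\<And>t N s \<xi> N' s' \<xi>'. t \<le> 1 \<Longrightarrow> fine_tagged \<delta> 0 t N s \<xi> \<Longrightarrow> fine_tagged \<delta> 0 t N' s' \<xi>' \<Longrightarrow>
        \<bar>riemann_sum f g N s \<xi> - riemann_sum f g N' s' \<xi>'\<bar> < \<epsilon> / 2" by blast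
    obtain n0 where n0: "\<And>n t. n \<ge> n0 \<Longrightarrow> t \<ge> 0 \<Longrightarrow> fine_tagged \<delta> 0 t (N n t) (s n t) (s n t)"
      using tail[OF \<open>\<delta> > 0\<close>] by blast
    have "\<bar>riemann_sum f g N' s' \<xi>' - I t\<bar> < \<epsilon>" if t: "t \<in> {0..1}" and Q: "fine_tagged \<delta> 0 t N' s' \<xi>'" for t N' s' \<xi>'
    proof -
      have "(\<lambda>n. \<bar>riemann_sum f g N' s' \<xi>' - X n t\<bar>) \<longlonglongrightarrow> \<bar>riemann_sum f g N' s' \<xi>' - I t\<bar>"
        by (intro tendsto_intros lim[OF t])
      moreover have "\<forall>n\<ge>n0. \<bar>riemann_sum f g N' s' \<xi>' - X n t\<bar> \<le> \<epsilon> / 2"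
        using \<delta>[OF _ Q] n0 t by (force simp: X_def intro: less_imp_le)
      ultimately have "\<bar>riemann_sum f g N' s' \<xi>' - I t\<bar> \<le> \<epsilon> / 2"
        by (intro LIMSEQ_le_const2) blast+
      with \<open>\<epsilon> > 0\<close> show ?thesis by simp
    qed
    with \<open>\<delta> > 0\<close> show "\<exists>\<delta>>0. \<forall>t\<in>{0..1}. \<forall>N s \<xi>. fine_tagged \<delta> 0 t N s \<xi> \<longrightarrow>
        \<bar>riemann_sum f g N s \<xi> - I t\<bar> < \<epsilon>" by blast
  qed
qed

lemma fine_tagged_snoc:
  assumes "fine_tagged \<delta> a b N s \<xi>" "b < c" "c - b < \<delta>"
  shows "fine_tagged \<delta> a c (Suc N) (s(Suc N := c)) (\<xi>(N := b))"
    and "riemann_sum f g (Suc N) (s(Suc N := c)) (\<xi>(N := b)) = riemann_sum f g N s \<xi> + f b * (g c - g b)"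
  using assms by (auto simp: fine_tagged_def is_partition_def less_Suc_eq riemann_sum_def)

text \<open>
  If \<open>b < c\<close> are close, a fine partition of \<open>[0,b]\<close> followed by the point \<open>c\<close> is a fine partition of
  \<open>[0,c]\<close>. The two Riemann sums differ by \<open>f b * (g c - g b)\<close>, and by uniformity both are within
  \<open>\<epsilon> / 3\<close> of the limits \<open>I b\<close> and \<open>I c\<close>. Thus additivity of the integral over adjacent intervals is
  bypassed.
\<close>

lemma uniform_limit_of_riemann_sums_continuous:
  assumes f: "continuous_on {0..1} f" and g: "continuous_on {0..1} g"
    and I: "\<And>\<epsilon>. \<epsilon> > 0 \<Longrightarrow> \<exists>\<delta>>0. \<forall>t\<in>{0..1}. \<forall>N s \<xi>. fine_tagged \<delta> 0 t N s \<xi> \<longrightarrow>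
      \<bar>riemann_sum f g N s \<xi> - I t\<bar> < \<epsilon>"
  shows "continuous_on {0..1} I"
  unfolding continuous_on_iff
proof (intro ballI allI impI)
  fix t \<epsilon> :: real assume t: "t \<in> {0..1}" and "\<epsilon> > 0"
  then have "\<epsilon> / 3 > 0" by simp
  from I[OF this] obtain \<delta> where \<delta>: "\<delta> > 0" "\<And>t N s \<xi>. t \<in> {0..1} \<Longrightarrow> fine_tagged \<delta> 0 t N s \<xi> \<Longrightarrow>
      \<bar>riemann_sum f g N s \<xi> - I t\<bar> < \<epsilon> / 3" by blast
  have "compact (f ` {0..1})" using f by (intro compact_continuous_image) auto
  then obtain B where B: "B > 0" "\<And>x. x \<in> {0..1} \<Longrightarrow> \<bar>f x\<bar> \<le> B"
    by (metis bounded_pos compact_imp_bounded image_eqI real_norm_def)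
  obtain \<delta>' where \<delta>': "\<delta>' > 0" "\<And>x. x \<in> {0..1} \<Longrightarrow> dist x t < \<delta>' \<Longrightarrow> dist (g x) (g t) < \<epsilon> / 3 / B"
    using g t \<open>\<epsilon> / 3 > 0\<close> B(1) unfolding continuous_on_iff by (metis divide_pos_pos)
  have close: "\<bar>I c - I b\<bar> < \<epsilon>"
    if bc: "b \<in> {0..1}" "c \<in> {0..1}" "b < c" "c - b < \<delta>" "\<bar>g c - g b\<bar> < \<epsilon> / 3 / B" for b c
  proof -
    obtain N s where "is_partition 0 b N s" "\<forall>i<N. s (Suc i) - s i < \<delta>"
      using fine_partition_exists[of 0 b \<delta>] bc \<delta>(1) by auto
    then have P: "fine_tagged \<delta> 0 b N s s"
      by (auto simp: fine_tagged_def is_partition_def less_imp_le)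
    have "\<bar>riemann_sum f g N s s - I b\<bar> < \<epsilon> / 3" by (rule \<delta>(2)[OF bc(1) P])
    moreover have "\<bar>riemann_sum f g N s s + f b * (g c - g b) - I c\<bar> < \<epsilon> / 3"
      using \<delta>(2)[OF bc(2) fine_tagged_snoc(1)[OF P bc(3,4)]] fine_tagged_snoc(2)[OF P bc(3,4)] by simp
    moreover have "\<bar>f b * (g c - g b)\<bar> < \<epsilon> / 3"
    proof -
      have "\<bar>f b\<bar> * \<bar>g c - g b\<bar> \<le> B * \<bar>g c - g b\<bar>"
        using B(2)[OF bc(1)] by (intro mult_right_mono) auto
      also have "\<dots> < B * (\<epsilon> / 3 / B)" using bc(5) B(1) by (intro mult_strict_left_mono)
      finally show ?thesis using B(1) by (simp add: abs_mult)
    qed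
    ultimately show ?thesis by linarith
  qed
  have "dist (I x) (I t) < \<epsilon>" if x: "x \<in> {0..1}" "dist x t < min \<delta> \<delta>'" for x
  proof -
    have g': "\<bar>g x - g t\<bar> < \<epsilon> / 3 / B" using \<delta>'(2)[OF x(1)] x(2) by (simp add: dist_real_def)
    show ?thesis
    proof (cases x t rule: linorder_cases)
      case less
      then show ?thesis using close[OF x(1) t] g' x(2) by (simp add: dist_real_def abs_minus_commute)
    next
      case greater
      then show ?thesis using close[OF t x(1)] g' x(2) by (simp add: dist_real_def)
    qed (use \<open>\<epsilon> > 0\<close> in simp)
  qed
  then show "\<exists>d>0. \<forall>x\<in>{0..1}. dist x t < d \<longrightarrow> dist (I x) (I t) < \<epsilon>"
    using \<delta>(1) \<delta>'(1) by (intro exI[of _ "min \<delta> \<delta>'"]) auto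
qed


section \<open>Comparison with the dyadic integral\<close>

text \<open>
  For \<open>m \<ge> dyadic_level t\<close> the point \<open>t\<close> lies on the grid of level \<open>m\<close>, so the left sum of level \<open>m\<close> is
  the left-tagged Riemann sum of a partition of \<open>[0,t]\<close> with mesh \<open>2 powr - m\<close>.
\<close>

lemma dyadic_sums_tendsto:
  assumes t: "t \<in> dyadics" and I: "has_young_integral f g 0 t I"
  shows "(\<lambda>n. left_sum (n + dyadic_level t) f g t) \<longlonglongrightarrow> I"
proof (rule LIMSEQ_I)
  fix \<epsilon> :: real assume "\<epsilon> > 0"
  with I obtain \<delta> where \<delta>: "\<delta> > 0" "\<And>N s \<xi>. fine_tagged \<delta> 0 t N s \<xi> \<Longrightarrow> \<bar>riemann_sum f g N s \<xi> - I\<bar> < \<epsilon>"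
    unfolding has_young_integral_iff_fine_tagged by blast
  obtain n0 where n0: "(1 / 2) ^ n0 < \<delta>" using real_arch_pow_inv[OF \<delta>(1), of "1 / 2"] by auto
  define l where "l = dyadic_level t"
  have "t \<in> dyadic_grid l"
    using t unfolding l_def dyadics_def dyadic_level_def by (auto intro: LeastI)
  then obtain k where k: "t = real k / 2 ^ l"
    by (auto simp: dyadic_grid_def dyadic_pt_def)
  have "norm (left_sum (n + l) f g t - I) < \<epsilon>" if n: "n \<ge> n0" for n
  proof -
    define m where "m = n + l"
    define N where "N = k * 2 ^ n"
    have tN: "2 ^ m * t = real N" by (simp add: k m_def N_def power_add)
    then have floor: "nat \<lfloor>2 ^ m * t\<rfloor> = N" by simp
    have mesh: "1 / 2 ^ m < \<delta>"
    proof -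
      have "(1 / 2 :: real) ^ m \<le> (1 / 2) ^ n0" using n by (intro power_decreasing) (auto simp: m_def)
      then show ?thesis using n0 by (simp add: power_one_over)
    qed
    have step: "dyadic_pt m (Suc i) - dyadic_pt m i = 1 / 2 ^ m" for i
      by (simp add: dyadic_pt_def diff_divide_distrib[symmetric])
    have less: "dyadic_pt m i < dyadic_pt m (Suc i)" for i
      by (simp add: dyadic_pt_def divide_strict_right_mono)
    have "dyadic_pt m N = t" by (simp add: dyadic_pt_def tN[symmetric])
    then have "fine_tagged \<delta> 0 t N (dyadic_pt m) (dyadic_pt m)"
      using mesh less by (auto simp: fine_tagged_def is_partition_def step less_imp_le) (simp add: dyadic_pt_def)
    from \<delta>(2)[OF this] show ?thesis by (simp add: riemann_sum_def left_sum_def floor flip: m_def)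
  qed
  then show "\<exists>n0. \<forall>n\<ge>n0. norm (left_sum (n + dyadic_level t) f g t - I) < \<epsilon>"
    unfolding l_def by blast
qed

lemma dyadics_approx:
  assumes "t \<in> {0..1}"
  obtains x where "\<And>n. x n \<in> dyadics" "x \<longlonglongrightarrow> t"
proof -
  define x where "x n = dyadic_pt n (nat \<lfloor>2 ^ n * t\<rfloor>)" for n
  have eq: "x n = of_int \<lfloor>2 ^ n * t\<rfloor> / 2 ^ n" for n
    using assms by (simp add: x_def dyadic_pt_def)
  have bounds: "t - (1 / 2) ^ n \<le> x n" "x n \<le> t" for n
  proof -
    have a: "2 ^ n * t - 1 \<le> of_int \<lfloor>2 ^ n * t\<rfloor>" "of_int \<lfloor>2 ^ n * t\<rfloor> \<le> 2 ^ n * t"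
      by linarith+
    from divide_right_mono[OF a(1), of "2 ^ n"] show "t - (1 / 2) ^ n \<le> x n"
      by (simp add: eq diff_divide_distrib power_one_over)
    from divide_right_mono[OF a(2), of "2 ^ n"] show "x n \<le> t" by (simp add: eq)
  qed
  have "x n \<in> dyadics" for n
  proof -
    have "2 ^ n * t \<le> 2 ^ n" using assms by (simp add: mult_left_le)
    then have "(of_int \<lfloor>2 ^ n * t\<rfloor> :: real) \<le> of_int (2 ^ n)"
      using order_trans[OF of_int_floor_le[of "2 ^ n * t"], of "2 ^ n"] by simp
    then have "\<lfloor>2 ^ n * t\<rfloor> \<le> 2 ^ n" by (simp only: of_int_le_iff)
    then have "nat \<lfloor>2 ^ n * t\<rfloor> \<le> 2 ^ n" by (simp add: nat_le_iff)
    then have "x n \<in> dyadic_grid n" unfolding x_def dyadic_grid_def by (intro imageI) simp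
    then show ?thesis by (auto simp: dyadics_def)
  qed
  moreover have "x \<longlonglongrightarrow> t"
  proof (rule real_tendsto_sandwich)
    show "(\<lambda>n. t - (1 / 2) ^ n) \<longlonglongrightarrow> t"
      using tendsto_diff[OF tendsto_const LIMSEQ_realpow_zero[of "1 / 2"], of t] by simp
  qed (use bounds in auto)
  ultimately show ?thesis using that by blast
qed

lemma dyadics_subset: "dyadics \<subseteq> {0..1}"
proof -
  have "real k \<le> 2 ^ n" if "k \<le> 2 ^ n" for k n
    using of_nat_mono[OF that, where 'a = real] by simp
  then show ?thesis by (auto simp: dyadics_def dyadic_grid_def dyadic_pt_def)
qed

lemma continuous_on_eq_of_eq_dyadics:
  fixes F G :: "real \<Rightarrow> real"
  assumes "continuous_on {0..1} F" "continuous_on {0..1} G" "\<And>t. t \<in> dyadics \<Longrightarrow> F t = G t" "t \<in> {0..1}"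
  shows "F t = G t"
proof -
  obtain x where x: "\<And>n. x n \<in> dyadics" "x \<longlonglongrightarrow> t" using dyadics_approx[OF assms(4)] by blast
  have ev: "\<forall>\<^sub>F n in sequentially. x n \<in> {0..1}"
    using x(1) dyadics_subset by (intro always_eventually) blast
  have "(\<lambda>n. F (x n)) \<longlonglongrightarrow> F t"
    by (rule continuous_on_tendsto_compose[OF assms(1) x(2) assms(4) ev])
  moreover have "(\<lambda>n. F (x n)) \<longlonglongrightarrow> G t"
    using continuous_on_tendsto_compose[OF assms(2) x(2) assms(4) ev] by (simp add: assms(3)[OF x(1)])
  ultimately show ?thesis by (rule LIMSEQ_unique)
qed

text \<open>
  One direction of integration only: the hypotheses are invariant under exchanging \<open>(f, r)\<close> and
  \<open>(g, s)\<close>, so the statement for the integral of \<open>g\<close> against \<open>f\<close> is another instance.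
\<close>

lemma fs_integral_eq_young_integral:
  assumes f: "continuous_on {0..1} f" and g: "continuous_on {0..1} g"
    and r: "r \<ge> 1" and s: "s \<ge> 1" and rs: "1 / r + 1 / s > 1"
    and var: "has_finite_variation r f" "has_finite_variation s g"
  shows "fs_integral_exists f g"
    and "t \<in> {0..1} \<Longrightarrow> young_integrable f g 0 t"
    and "t \<in> {0..1} \<Longrightarrow> fs_integral f g t = young_integral f g 0 t"
proof -
  obtain I where I: "\<And>\<epsilon>. \<epsilon> > 0 \<Longrightarrow> \<exists>\<delta>>0. \<forall>t\<in>{0..1}. \<forall>N s \<xi>. fine_tagged \<delta> 0 t N s \<xi> \<longrightarrow>
      \<bar>riemann_sum f g N s \<xi> - I t\<bar> < \<epsilon>"
    using young_integral_uniform_limit[OF f r s rs var] by blast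
  have young: "has_young_integral f g 0 t (I t)" if "t \<in> {0..1}" for t
    unfolding has_young_integral_iff_fine_tagged using I that by meson
  have cont: "continuous_on {0..1} I"
    by (rule uniform_limit_of_riemann_sums_continuous[OF f g I])
  have dyadic: "(\<lambda>n. left_sum (n + dyadic_level t) f g t) \<longlonglongrightarrow> I t" if "t \<in> dyadics" for t
    using that dyadics_subset by (intro dyadic_sums_tendsto young) auto
  have ext: "is_fs_extension f g I"
    using cont limI[OF dyadic] by (auto simp: is_fs_extension_def dyadic_integral_def)
  then show "fs_integral_exists f g"
    using dyadic by (auto simp: fs_integral_exists_def dyadic_integral_exists_def convergent_def)
  show "young_integrable f g 0 t" if "t \<in> {0..1}"
    using young[OF that] by (auto simp: young_integrable_def)
  show "fs_integral f g t = young_integral f g 0 t" if t: "t \<in> {0..1}"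
  proof -
    have "is_fs_extension f g (fs_integral f g)"
      using someI[of "is_fs_extension f g" I] ext by (simp add: fs_integral_def)
    then have "continuous_on {0..1} (fs_integral f g)" "\<And>t. t \<in> dyadics \<Longrightarrow> fs_integral f g t = I t"
      using ext by (simp_all add: is_fs_extension_def)
    then have "fs_integral f g t = I t"
      using cont t continuous_on_eq_of_eq_dyadics[of "fs_integral f g" I t] by blast
    also have "I t = young_integral f g 0 t"
      using young_integral_eqI[OF young[OF t]] t by simp
    finally show ?thesis .
  qed
qed

theorem corollary4p3:
  fixes p q r s :: real and f g :: "real \<Rightarrow> real"
  assumes "p > 1" and "q > 1" and "1 / p + 1 / q \<ge> 1"
    and "f \<in> energy_space p" and "g \<in> energy_space q"
    and "r \<ge> 1" and "s \<ge> 1"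
    and "has_finite_variation r f" and "has_finite_variation s g"
    and "1 / r + 1 / s > 1"
  shows "fs_integral_exists f g \<and> fs_integral_exists g f \<and>
    (\<forall>t\<in>{0..1}.
       young_integrable f g 0 t \<and> young_integrable g f 0 t \<and>
       fs_integral f g t = young_integral f g 0 t \<and>
       fs_integral g f t = young_integral g f 0 t)"
proof -
  have "continuous_on {0..1} f" "continuous_on {0..1} g"
    using assms(4,5) by (auto simp: energy_space_def)
  moreover have "1 / s + 1 / r > 1" using assms(10) by simp
  ultimately show ?thesis
    using fs_integral_eq_young_integral[of f g r s] fs_integral_eq_young_integral[of g f s r] assms(6-10)
    by blast
qed

end
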